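(* Let $\Gamma$ be a finite mixed graph and $G_\Gamma$ the twisted right-angled Artin group based on $\Gamma$. Then $G_\Gamma$ has torsion (i.e. contains a non-trivial element of finite order) if and only if there is a clique $C$ in $\Gamma$ whose vertices form a closed cycle.
   Context: A mixed graph $\Gamma$ consists of a finite vertex set $V$, a set $E$ of two-element subsets of $V$ (edges), and a subset $D\subseteq E$ of directed edges, each $e\in D$ having an origin and a terminus, which are the two distinct endpoints of $e$. An undirected edge $\{a,b\}\in E\setminus D$ is written $[a,b]$; a directed edge with origin $a$ and terminus $b$ is written $[a,b\rangle$. The twisted right-angled Artin group (tRAAG) based on $\Gamma$ is $G_\Gamma=\langle V\mid ab=ba \text{ if }[a,b]\text{ is an undirected edge},\ aba=b\text{ if }[a,b\rangle\text{ is a directed edge}\rangle$. A clique is a set of vertices any two distinct of which are joined by an edge of $E$ (directed or not). The vertices of a clique $C$ form a closed cycle if they can be listed, without repetition, as $C=\{a_1,\dots,a_n\}$, $n\ge 3$, so that $[a_1,a_2\rangle,[a_2,a_3\rangle,\dots,[a_{n-1},a_n\rangle,[a_n,a_1\rangle$ are directed edges of $\Gamma$. *)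

theory Defs
  imports "HOL-Algebra.Algebra"
begin

section \<open>Groups given by generators and relations\<close>

datatype 'a letter = Gen 'a | GenInv 'a

primrec letter_base :: "'a letter \<Rightarrow> 'a" where
  "letter_base (Gen a) = a"
| "letter_base (GenInv a) = a"

primrec letter_inv :: "'a letter \<Rightarrow> 'a letter" where
  "letter_inv (Gen a) = GenInv a"
| "letter_inv (GenInv a) = Gen a"

definition group_words :: "'a set \<Rightarrow> 'a letter list set" where
  "group_words S = {w. letter_base ` set w \<subseteq> S}"

text \<open>
  The least congruence on the monoid of words over \<open>S\<close> and its formal inverses
  that contains free cancellation and identifies \<open>u\<close> with \<open>v\<close> for each relation
  \<open>(u, v)\<close>, read as \<open>u = v\<close>. Pairs that are not made of words over \<open>S\<close> are ignored.
\<close>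

inductive pres_eq :: "'a set \<Rightarrow> ('a letter list \<times> 'a letter list) set
    \<Rightarrow> 'a letter list \<Rightarrow> 'a letter list \<Rightarrow> bool"
  for S R where
  pres_refl: "w \<in> group_words S \<Longrightarrow> pres_eq S R w w"
| pres_sym: "pres_eq S R u v \<Longrightarrow> pres_eq S R v u"
| pres_trans: "pres_eq S R u v \<Longrightarrow> pres_eq S R v w \<Longrightarrow> pres_eq S R u w"
| pres_append: "pres_eq S R u u' \<Longrightarrow> pres_eq S R v v' \<Longrightarrow> pres_eq S R (u @ v) (u' @ v')"
| pres_cancel: "letter_base x \<in> S \<Longrightarrow> pres_eq S R [x, letter_inv x] []"
| pres_rel: "(u, v) \<in> R \<Longrightarrow> u \<in> group_words S \<Longrightarrow> v \<in> group_words S \<Longrightarrow> pres_eq S R u v"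

definition pres_class :: "'a set \<Rightarrow> ('a letter list \<times> 'a letter list) set
    \<Rightarrow> 'a letter list \<Rightarrow> 'a letter list set" where
  "pres_class S R w = {v. pres_eq S R w v}"

definition presented_group :: "'a set \<Rightarrow> ('a letter list \<times> 'a letter list) set
    \<Rightarrow> 'a letter list set monoid" where
  "presented_group S R =
    \<lparr>carrier = pres_class S R ` group_words S,
     monoid.mult = (\<lambda>A B. \<Union>u\<in>A. \<Union>v\<in>B. pres_class S R (u @ v)),
     one = pres_class S R []\<rparr>"

lemma group_words_Nil [simp]: "[] \<in> group_words S"
  and group_words_Cons [simp]:
    "x # w \<in> group_words S \<longleftrightarrow> letter_base x \<in> S \<and> w \<in> group_words S"
  and group_words_append [simp]:
    "u @ v \<in> group_words S \<longleftrightarrow> u \<in> group_words S \<and> v \<in> group_words S"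
  by (auto simp: group_words_def)

lemma letter_base_inv [simp]: "letter_base (letter_inv x) = letter_base x"
  by (cases x) auto

lemma letter_inv_inv [simp]: "letter_inv (letter_inv x) = x"
  by (cases x) auto

lemma pres_eq_words: "pres_eq S R u v \<Longrightarrow> u \<in> group_words S \<and> v \<in> group_words S"
  by (induction rule: pres_eq.induct) auto

lemma pres_class_eq_iff:
  assumes "u \<in> group_words S"
  shows "pres_class S R u = pres_class S R v \<longleftrightarrow> pres_eq S R u v"
proof
  assume "pres_class S R u = pres_class S R v"
  moreover have "u \<in> pres_class S R u"
    using assms by (simp add: pres_class_def pres_refl)
  ultimately have "pres_eq S R v u"
    by (simp add: pres_class_def)
  then show "pres_eq S R u v"
    by (rule pres_sym)
next
  assume uv: "pres_eq S R u v"
  have "pres_eq S R u w \<longleftrightarrow> pres_eq S R v w" for w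
    using pres_trans[OF uv, of w] pres_trans[OF pres_sym[OF uv], of w] by (rule iffI[rotated])
  then show "pres_class S R u = pres_class S R v"
    by (simp add: pres_class_def)
qed

lemma carrier_presented_group:
  "carrier (presented_group S R) = pres_class S R ` group_words S"
  by (simp add: presented_group_def)

lemma one_presented_group: "\<one>\<^bsub>presented_group S R\<^esub> = pres_class S R []"
  by (simp add: presented_group_def)

lemma mult_presented_group:
  assumes "u \<in> group_words S" "v \<in> group_words S"
  shows "pres_class S R u \<otimes>\<^bsub>presented_group S R\<^esub> pres_class S R v = pres_class S R (u @ v)"
proof -
  have eq: "pres_class S R (u' @ v') = pres_class S R (u @ v)"
    if "u' \<in> pres_class S R u" "v' \<in> pres_class S R v" for u' v'
    using that assms pres_class_eq_iff[of "u @ v" S R "u' @ v'"] pres_append[of S R u u' v v']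
    by (simp add: pres_class_def)
  have "pres_class S R u \<noteq> {}" "pres_class S R v \<noteq> {}"
    using assms by (auto simp: pres_class_def intro: pres_refl)
  moreover have "(\<Union>u'\<in>pres_class S R u. \<Union>v'\<in>pres_class S R v. pres_class S R (u' @ v'))
      = (\<Union>u'\<in>pres_class S R u. \<Union>v'\<in>pres_class S R v. pres_class S R (u @ v))"
    by (intro SUP_cong refl eq)
  ultimately show ?thesis
    by (simp add: presented_group_def)
qed

lemma pres_eq_inverse_left:
  "w \<in> group_words S \<Longrightarrow> pres_eq S R (rev (map letter_inv w) @ w) []"
proof (induction w)
  case Nil
  then show ?case by (simp add: pres_refl)
next
  case (Cons x w)
  let ?r = "rev (map letter_inv w)"
  have r: "?r \<in> group_words S"
    using Cons.prems by (auto simp: group_words_def)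
  have "pres_eq S R [letter_inv x, x] []"
    using pres_cancel[of "letter_inv x" S R] Cons.prems by simp
  then have "pres_eq S R (?r @ ([letter_inv x, x] @ w)) (?r @ ([] @ w))"
    using Cons.prems r by (intro pres_append pres_refl) auto
  then have "pres_eq S R (rev (map letter_inv (x # w)) @ x # w) (?r @ w)"
    by simp
  moreover have "pres_eq S R (?r @ w) []"
    using Cons by simp
  ultimately show ?case
    by (rule pres_trans)
qed

lemma group_presented_group: "group (presented_group S R)"
proof (rule groupI)
  fix x y z
  assume "x \<in> carrier (presented_group S R)" "y \<in> carrier (presented_group S R)"
    "z \<in> carrier (presented_group S R)"
  then show "x \<otimes>\<^bsub>presented_group S R\<^esub> y \<otimes>\<^bsub>presented_group S R\<^esub> z =
      x \<otimes>\<^bsub>presented_group S R\<^esub> (y \<otimes>\<^bsub>presented_group S R\<^esub> z)"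
    by (auto simp: carrier_presented_group mult_presented_group)
next
  fix x
  assume "x \<in> carrier (presented_group S R)"
  then obtain w where w: "w \<in> group_words S" "x = pres_class S R w"
    by (auto simp: carrier_presented_group)
  let ?v = "rev (map letter_inv w)"
  have v: "?v \<in> group_words S"
    using w by (auto simp: group_words_def)
  have "pres_class S R ?v \<otimes>\<^bsub>presented_group S R\<^esub> x = \<one>\<^bsub>presented_group S R\<^esub>"
    using w v pres_eq_inverse_left[of w S R]
    by (simp add: mult_presented_group one_presented_group pres_class_eq_iff)
  with v show "\<exists>y\<in>carrier (presented_group S R).
      y \<otimes>\<^bsub>presented_group S R\<^esub> x = \<one>\<^bsub>presented_group S R\<^esub>"
    by (auto simp: carrier_presented_group)
qed (auto simp: carrier_presented_group one_presented_group mult_presented_group)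

section \<open>Mixed graphs and twisted right-angled Artin groups\<close>

text \<open>
  The functions \<open>origin\<close> and \<open>terminus\<close> are only meaningful on directed edges;
  their values elsewhere are irrelevant.
\<close>

record 'a mixed_graph =
  verts :: "'a set"
  edges :: "'a set set"
  directed :: "'a set set"
  origin :: "'a set \<Rightarrow> 'a"
  terminus :: "'a set \<Rightarrow> 'a"

definition is_mixed_graph :: "'a mixed_graph \<Rightarrow> bool" where
  "is_mixed_graph \<Gamma> \<longleftrightarrow>
    finite (verts \<Gamma>) \<and>
    (\<forall>e\<in>edges \<Gamma>. e \<subseteq> verts \<Gamma> \<and> card e = 2) \<and>
    directed \<Gamma> \<subseteq> edges \<Gamma> \<and>
    (\<forall>e\<in>directed \<Gamma>. origin \<Gamma> e \<noteq> terminus \<Gamma> e \<and> e = {origin \<Gamma> e, terminus \<Gamma> e})"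

definition undirected_edge :: "'a mixed_graph \<Rightarrow> 'a \<Rightarrow> 'a \<Rightarrow> bool" where
  "undirected_edge \<Gamma> a b \<longleftrightarrow> {a, b} \<in> edges \<Gamma> - directed \<Gamma>"

definition directed_edge :: "'a mixed_graph \<Rightarrow> 'a \<Rightarrow> 'a \<Rightarrow> bool" where
  "directed_edge \<Gamma> a b \<longleftrightarrow> (\<exists>e\<in>directed \<Gamma>. origin \<Gamma> e = a \<and> terminus \<Gamma> e = b)"

definition tRAAG_relations :: "'a mixed_graph \<Rightarrow> ('a letter list \<times> 'a letter list) set" where
  "tRAAG_relations \<Gamma> =
    {([Gen a, Gen b], [Gen b, Gen a]) | a b. undirected_edge \<Gamma> a b} \<union>
    {([Gen a, Gen b, Gen a], [Gen b]) | a b. directed_edge \<Gamma> a b}"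

definition tRAAG :: "'a mixed_graph \<Rightarrow> 'a letter list set monoid" where
  "tRAAG \<Gamma> = presented_group (verts \<Gamma>) (tRAAG_relations \<Gamma>)"

definition clique :: "'a mixed_graph \<Rightarrow> 'a set \<Rightarrow> bool" where
  "clique \<Gamma> C \<longleftrightarrow> C \<subseteq> verts \<Gamma> \<and> (\<forall>a\<in>C. \<forall>b\<in>C. a \<noteq> b \<longrightarrow> {a, b} \<in> edges \<Gamma>)"

definition forms_closed_cycle :: "'a mixed_graph \<Rightarrow> 'a set \<Rightarrow> bool" where
  "forms_closed_cycle \<Gamma> C \<longleftrightarrow>
    (\<exists>as. distinct as \<and> set as = C \<and> length as \<ge> 3 \<and>
      (\<forall>i<length as. directed_edge \<Gamma> (as ! i) (as ! (Suc i mod length as))))"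

definition has_torsion :: "('g, 'm) monoid_scheme \<Rightarrow> bool" where
  "has_torsion G \<longleftrightarrow>
    (\<exists>x\<in>carrier G. x \<noteq> \<one>\<^bsub>G\<^esub> \<and> (\<exists>n::nat. n > 0 \<and> x [^]\<^bsub>G\<^esub> n = \<one>\<^bsub>G\<^esub>))"

end

theory Submission
  imports Defs
begin

text \<open>
  An arc \<open>[a,b\<rangle>\<close> says that conjugation by \<open>b\<close> inverts \<open>a\<close>. So two adjacent generators can
  always be exchanged at the price of inverting one of them, and everything below is a
  matter of keeping track of these signs.

  Both sides of the equivalence are compared with a third condition, the existence of a
  \<^emph>\<open>sinkless clique\<close>: a nonempty clique \<open>T\<close> in which every vertex has an out-neighbour in
  \<open>T\<close>. The vertices of a closed cycle form such a set if they are a clique; conversely,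
  following out-neighbours inside \<open>T\<close> must eventually close up, and the cycle so found has
  length at least 3 because an edge has only one direction.

  \<^emph>\<open>A sinkless clique gives torsion.\<close> In a sinkless clique of least cardinality every vertex
  has exactly one out-neighbour (\<open>minimal_sinkless_clique_unique_out_neighbour\<close>). Let \<open>w\<close> be
  the product of its vertices in some order. In \<open>w\<^sup>2\<close> the two occurrences of a vertex \<open>a\<close> are
  separated by every other vertex just once, so when they are brought together exactly
  one sign change happens to \<open>a\<close> and they cancel; hence \<open>w\<^sup>2 = 1\<close>
  (\<open>clique_product_trivial\<close>). The action on the integers described next shows \<open>w \<noteq> 1\<close>.

  \<^emph>\<open>Torsion gives a sinkless clique.\<close> Let \<open>w \<noteq> 1\<close> have finite order. Two points matter.

  First, a word in which every generator occurs an even number of times represents an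
  element of infinite order or the identity (\<open>even_torsion_trivial\<close>). To see this let the
  group act on the dual of a ring of formal power series in partially commuting
  variables \<open>X\<^sub>a\<close> with \<open>X\<^sub>a\<^sup>2 = 0\<close>, where \<open>a\<close> acts as \<open>1 + X\<^sub>a\<close> followed by the sign change of
  all \<open>X\<^sub>c\<close> with an arc from \<open>c\<close> to \<open>a\<close>; the relation \<open>X\<^sub>a\<^sup>2 = 0\<close> makes the sign change of \<open>X\<^sub>a\<close>
  invert \<open>1 + X\<^sub>a\<close>. This is the Magnus representation with a twist. An even word acts
  unipotently on integer-valued functions, so if it is torsion it acts trivially. The
  action is faithful: if an element is written with the least possible number of powers
  of generators, its coefficient at the corresponding monomial is, up to sign, the
  product of the exponents.

  Secondly, apply this to \<open>w\<^sup>2\<close>, which is even: \<open>w\<^sup>2 = 1\<close>. So \<open>w\<close> itself is not even, and the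
  set \<open>T\<close> of generators occurring an odd number of times in \<open>w\<close> is nonempty. Two small
  representations show that it is a sinkless clique. For \<open>a \<in> T\<close> let \<open>a\<close> translate the
  integers by 1 and let the other generators act by the sign with which they conjugate
  \<open>a\<close>. Then \<open>w\<close> acts as \<open>n \<mapsto> \<plusminus>n + e\<close> with \<open>e\<close> odd, and an involution of this form must have
  the sign \<open>-1\<close>, so that \<open>a\<close> has an out-neighbour in \<open>T\<close> (\<open>involution_out_neighbour\<close>). If \<open>a\<close>
  and \<open>b\<close> in \<open>T\<close> were not adjacent, \<open>a\<close> and \<open>b\<close> could be mapped to the two standard
  generators of the Heisenberg group, the others acting by signs, and comparing central
  coordinates in \<open>w\<^sup>2 = 1\<close> would make an odd number even (\<open>involution_joined\<close>).
\<close>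

section \<open>Words and presentations\<close>

text \<open>
  The universal property of a presentation, for actions: generators acting by
  permutations of \<open>M\<close> that satisfy the relations define an action of the presented group.
\<close>

lemma foldr_respects_pres_eq:
  assumes eq: "pres_eq S R u v"
    and closed: "\<And>x s. letter_base x \<in> S \<Longrightarrow> s \<in> M \<Longrightarrow> act x s \<in> M"
    and cancel: "\<And>x s. letter_base x \<in> S \<Longrightarrow> s \<in> M \<Longrightarrow> act x (act (letter_inv x) s) = s"
    and rel: "\<And>u v s. (u, v) \<in> R \<Longrightarrow> u \<in> group_words S \<Longrightarrow> v \<in> group_words S \<Longrightarrow> s \<in> M
      \<Longrightarrow> foldr act u s = foldr act v s"
    and s: "s \<in> M"
  shows "foldr act u s = foldr act v s"
proof -
  have foldr_closed: "foldr act w s \<in> M" if "w \<in> group_words S" "s \<in> M" for w s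
    using that(1) by (induction w) (simp_all add: closed that(2))
  show ?thesis
    using eq s
  proof (induction arbitrary: s rule: pres_eq.induct)
    case (pres_append u u' v v')
    then show ?case
      using foldr_closed[of v' s] pres_eq_words[of S R v v'] by simp
  next
    case (pres_rel u v)
    then show ?case by (rule rel)
  qed (auto simp: cancel)
qed

text \<open>
  The length of the filtered list is the sum of the multiplicities of its entries. This
  turns the sign with which a word conjugates a generator into information about which
  generators occur an odd number of times.
\<close>

lemma odd_length_filter_imp_odd_count:
  assumes "odd (length (filter P l))"
  shows "\<exists>v. P v \<and> odd (count_list l v)"
proof (rule ccontr)
  assume no: "\<nexists>v. P v \<and> odd (count_list l v)"
  have "count_list (filter P l) v = count_list l v" if "P v" for v
    using that by (induction l) auto
  then have "even (count_list (filter P l) v)" if "v \<in> set (filter P l)" for v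
    using no that by auto
  then have "even (\<Sum>v\<in>set (filter P l). count_list (filter P l) v)"
    by (rule dvd_sum)
  then show False
    using assms sum_count_set[of "filter P l" "set (filter P l)"] by simp
qed

definition flip :: "bool \<Rightarrow> 'a letter \<Rightarrow> 'a letter" where
  "flip c x = (if c then letter_inv x else x)"

lemma letter_base_flip [simp]: "letter_base (flip c x) = letter_base x"
  by (simp add: flip_def)

lemma flip_simps [simp]: "flip False x = x" "flip True x = letter_inv x"
  by (simp_all add: flip_def)

primrec letter_sign :: "'a letter \<Rightarrow> int" where
  "letter_sign (Gen a) = 1"
| "letter_sign (GenInv a) = -1"

lemma letter_sign_inv [simp]: "letter_sign (letter_inv x) = - letter_sign x"
  by (cases x) auto

lemma letter_sign_nonzero: "letter_sign x \<noteq> 0"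
  by (cases x) auto

lemma odd_letter_sign [simp]: "odd (letter_sign x)"
  by (cases x) auto

lemma letter_eqI: "letter_base x = letter_base y \<Longrightarrow> x = y \<or> y = letter_inv x"
  by (cases x; cases y) auto

lemma (in group) inverting_relations:
  assumes "x \<in> carrier G" "y \<in> carrier G" "x \<otimes> y \<otimes> x = y"
  shows "x \<otimes> y = y \<otimes> inv x" "inv x \<otimes> y = y \<otimes> x"
    "x \<otimes> inv y = inv y \<otimes> inv x" "inv x \<otimes> inv y = inv y \<otimes> x"
proof -
  show 1: "x \<otimes> y = y \<otimes> inv x"
    using assms by (metis inv_closed inv_solve_right m_closed)
  show 2: "inv x \<otimes> y = y \<otimes> x"
    using assms by (metis inv_closed inv_solve_left m_assoc m_closed)
  show "x \<otimes> inv y = inv y \<otimes> inv x"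
    using 2 assms by (metis inv_closed inv_solve_left inv_solve_right m_assoc m_closed)
  show "inv x \<otimes> inv y = inv y \<otimes> x"
    using 1 assms by (metis inv_closed inv_solve_left inv_solve_right m_assoc m_closed)
qed

lemma (in group) commuting_relations:
  assumes "x \<in> carrier G" "y \<in> carrier G" "x \<otimes> y = y \<otimes> x"
  shows "inv x \<otimes> y = y \<otimes> inv x"
    "x \<otimes> inv y = inv y \<otimes> x" "inv x \<otimes> inv y = inv y \<otimes> inv x"
proof -
  show "inv x \<otimes> y = y \<otimes> inv x"
    using assms by (metis inv_closed inv_solve_left inv_solve_right m_assoc m_closed)
  show "x \<otimes> inv y = inv y \<otimes> x"
    using assms by (metis inv_closed inv_solve_left inv_solve_right m_assoc m_closed)
  show "inv x \<otimes> inv y = inv y \<otimes> inv x"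
    using assms by (metis inv_mult_group)
qed

section \<open>Exchanging letters in a tRAAG\<close>

locale tRAAG_graph =
  fixes \<Gamma> :: "'a mixed_graph"
  assumes mixed: "is_mixed_graph \<Gamma>"
begin

abbreviation arc :: "'a \<Rightarrow> 'a \<Rightarrow> bool" where
  "arc \<equiv> directed_edge \<Gamma>"

abbreviation joined :: "'a \<Rightarrow> 'a \<Rightarrow> bool" where
  "joined a b \<equiv> {a, b} \<in> edges \<Gamma>"

abbreviation peq :: "'a letter list \<Rightarrow> 'a letter list \<Rightarrow> bool" (infix "\<asymp>" 50) where
  "u \<asymp> v \<equiv> pres_eq (verts \<Gamma>) (tRAAG_relations \<Gamma>) u v"

abbreviation words :: "'a letter list set" where
  "words \<equiv> group_words (verts \<Gamma>)"

lemma joined_sym: "joined a b \<Longrightarrow> joined b a"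
  by (simp add: insert_commute)

lemma joinedD: "joined a b \<Longrightarrow> a \<noteq> b \<and> a \<in> verts \<Gamma> \<and> b \<in> verts \<Gamma>"
  using mixed by (fastforce simp: is_mixed_graph_def)

lemma arc_edge: "arc a b \<Longrightarrow> {a, b} \<in> directed \<Gamma>"
  using mixed by (auto simp: is_mixed_graph_def directed_edge_def)

lemma arc_joined: "arc a b \<Longrightarrow> joined a b"
  using mixed arc_edge by (auto simp: is_mixed_graph_def)

lemma arc_irrefl [simp]: "\<not> arc a a"
  using arc_joined joinedD by blast

lemma arc_asym:
  assumes "arc a b"
  shows "\<not> arc b a"
proof
  assume "arc b a"
  from assms obtain e where e: "e \<in> directed \<Gamma>" "origin \<Gamma> e = a" "terminus \<Gamma> e = b"
    by (auto simp: directed_edge_def)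
  from \<open>arc b a\<close> obtain e' where e': "e' \<in> directed \<Gamma>" "origin \<Gamma> e' = b" "terminus \<Gamma> e' = a"
    by (auto simp: directed_edge_def)
  have "e = {a, b}" "e' = {b, a}" "a \<noteq> b"
    using e e' mixed by (auto simp: is_mixed_graph_def)
  then have "e = e'" by auto
  then show False using e e' \<open>a \<noteq> b\<close> by auto
qed

lemma undirected_edgeD:
  "undirected_edge \<Gamma> a b \<Longrightarrow> joined a b \<and> \<not> arc a b \<and> \<not> arc b a"
  using arc_edge[of a b] arc_edge[of b a] by (auto simp: undirected_edge_def insert_commute)

lemma joined_cases:
  assumes "joined a b"
  obtains "undirected_edge \<Gamma> a b" | "arc a b" | "arc b a"
proof (cases "{a, b} \<in> directed \<Gamma>")
  case True
  then have "{a, b} = {origin \<Gamma> {a, b}, terminus \<Gamma> {a, b}}"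
    using mixed by (auto simp: is_mixed_graph_def)
  then have "arc a b \<or> arc b a"
    using True by (force simp: directed_edge_def doubleton_eq_iff)
  then show ?thesis using that by auto
next
  case False
  then show ?thesis using assms that(1) by (simp add: undirected_edge_def)
qed

lemma tRAAG_foldr_respects:
  assumes eq: "u \<asymp> v"
    and closed: "\<And>x s. s \<in> M \<Longrightarrow> act x s \<in> M"
    and cancel: "\<And>x s. s \<in> M \<Longrightarrow> act x (act (letter_inv x) s) = s"
    and commute: "\<And>a b s. undirected_edge \<Gamma> a b \<Longrightarrow> s \<in> M
      \<Longrightarrow> act (Gen a) (act (Gen b) s) = act (Gen b) (act (Gen a) s)"
    and invert: "\<And>a b s. arc a b \<Longrightarrow> s \<in> M
      \<Longrightarrow> act (Gen a) (act (Gen b) (act (Gen a) s)) = act (Gen b) s"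
    and s: "s \<in> M"
  shows "foldr act u s = foldr act v s"
  using eq
proof (rule foldr_respects_pres_eq)
  fix u v s
  assume "(u, v) \<in> tRAAG_relations \<Gamma>" "s \<in> M"
  then show "foldr act u s = foldr act v s"
    by (auto simp: tRAAG_relations_def intro: commute invert)
qed (use closed cancel s in auto)

abbreviation word_class :: "'a letter list \<Rightarrow> 'a letter list set" where
  "word_class \<equiv> pres_class (verts \<Gamma>) (tRAAG_relations \<Gamma>)"

lemma group_tRAAG: "group (tRAAG \<Gamma>)"
  unfolding tRAAG_def by (rule group_presented_group)

lemma word_class_simps:
  "carrier (tRAAG \<Gamma>) = word_class ` words"
  "\<one>\<^bsub>tRAAG \<Gamma>\<^esub> = word_class []"
  "u \<in> words \<Longrightarrow> v \<in> words \<Longrightarrow> word_class u \<otimes>\<^bsub>tRAAG \<Gamma>\<^esub> word_class v = word_class (u @ v)"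
  "u \<in> words \<Longrightarrow> word_class u = word_class v \<longleftrightarrow> u \<asymp> v"
  by (simp_all add: tRAAG_def carrier_presented_group one_presented_group mult_presented_group
      pres_class_eq_iff)

lemma inv_generator_class:
  assumes "a \<in> verts \<Gamma>"
  shows "inv\<^bsub>tRAAG \<Gamma>\<^esub> word_class [Gen a] = word_class [GenInv a]"
  using assms pres_cancel[of "GenInv a" "verts \<Gamma>" "tRAAG_relations \<Gamma>"]
  by (intro group.inv_equality[OF group_tRAAG]) (auto simp: word_class_simps)

lemma letter_swap_arc:
  assumes "arc (letter_base x) (letter_base y)"
  shows "[x, y] \<asymp> [y, letter_inv x]"
proof -
  obtain a b where ab: "a = letter_base x" "b = letter_base y" by simp
  have v: "a \<in> verts \<Gamma>" "b \<in> verts \<Gamma>"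
    using assms arc_joined joinedD unfolding ab by blast+
  have car: "word_class [Gen a] \<in> carrier (tRAAG \<Gamma>)" "word_class [Gen b] \<in> carrier (tRAAG \<Gamma>)"
    using v by (auto simp: word_class_simps)
  have "[Gen a, Gen b, Gen a] \<asymp> [Gen b]"
    using assms v unfolding ab by (intro pres_rel) (auto simp: tRAAG_relations_def)
  then have "word_class [Gen a] \<otimes>\<^bsub>tRAAG \<Gamma>\<^esub> word_class [Gen b] \<otimes>\<^bsub>tRAAG \<Gamma>\<^esub> word_class [Gen a]
      = word_class [Gen b]"
    using v by (simp add: word_class_simps)
  note r = group.inverting_relations[OF group_tRAAG car this]
  show ?thesis
    using r v ab by (cases x; cases y) (auto simp: inv_generator_class word_class_simps)
qed

lemma letter_swap_undirected:
  assumes "undirected_edge \<Gamma> (letter_base x) (letter_base y)"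
  shows "[x, y] \<asymp> [y, x]"
proof -
  obtain a b where ab: "a = letter_base x" "b = letter_base y" by simp
  have v: "a \<in> verts \<Gamma>" "b \<in> verts \<Gamma>"
    using assms undirected_edgeD joinedD unfolding ab by blast+
  have car: "word_class [Gen a] \<in> carrier (tRAAG \<Gamma>)" "word_class [Gen b] \<in> carrier (tRAAG \<Gamma>)"
    using v by (auto simp: word_class_simps)
  have "[Gen a, Gen b] \<asymp> [Gen b, Gen a]"
    using assms v unfolding ab by (intro pres_rel) (auto simp: tRAAG_relations_def)
  then have c: "word_class [Gen a] \<otimes>\<^bsub>tRAAG \<Gamma>\<^esub> word_class [Gen b]
      = word_class [Gen b] \<otimes>\<^bsub>tRAAG \<Gamma>\<^esub> word_class [Gen a]"
    using v by (simp add: word_class_simps)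
  note r = c group.commuting_relations[OF group_tRAAG car c]
  show ?thesis
    using r v ab by (cases x; cases y) (auto simp: inv_generator_class word_class_simps)
qed

text \<open>
  Each of two adjacent letters is inverted when it passes the other one, if there is an
  arc from it to the other. Since the rule is the same for generators and for their
  inverses, it can be iterated.
\<close>

lemma letter_swap:
  assumes "joined (letter_base x) (letter_base y)"
  shows "[x, y] \<asymp> [flip (arc (letter_base y) (letter_base x)) y,
    flip (arc (letter_base x) (letter_base y)) x]"
  using assms
proof (cases rule: joined_cases)
  case 1
  then show ?thesis using letter_swap_undirected undirected_edgeD by auto
next
  case 2
  then show ?thesis using letter_swap_arc arc_asym by auto
next
  case 3
  then show ?thesis
    using letter_swap_arc[of "letter_inv y" x] arc_asym by (auto intro: pres_sym)
qed

lemma peq_words: "u \<asymp> v \<Longrightarrow> u \<in> words" "u \<asymp> v \<Longrightarrow> v \<in> words"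
  using pres_eq_words by blast+

lemma peq_context: "u \<asymp> v \<Longrightarrow> p \<in> words \<Longrightarrow> q \<in> words \<Longrightarrow> p @ u @ q \<asymp> p @ v @ q"
  by (intro pres_append pres_refl)

text \<open>
  Whether two letters invert each other depends on their base vertices alone, and these
  never change on the way. So it suffices to count how often \<open>y\<close> is inverted.
\<close>

lemma move_letter_left:
  assumes "\<forall>x\<in>set u. joined (letter_base x) (letter_base y)" "letter_base y \<in> verts \<Gamma>"
  shows "u @ [y] \<asymp> flip (odd (length (filter (arc (letter_base y)) (map letter_base u)))) y
    # map (\<lambda>x. flip (arc (letter_base x) (letter_base y)) x) u"
  using assms
proof (induction u)
  case Nil
  then show ?case by (auto intro: pres_refl)
next
  case (Cons x u)
  define y' where "y' = flip (odd (length (filter (arc (letter_base y)) (map letter_base u)))) y"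
  define u' where "u' = map (\<lambda>x. flip (arc (letter_base x) (letter_base y)) x) u"
  define x' where "x' = flip (arc (letter_base x) (letter_base y)) x"
  have j: "joined (letter_base x) (letter_base y)" using Cons.prems by simp
  have IH: "u @ [y] \<asymp> y' # u'"
    using Cons by (simp add: y'_def u'_def)
  have x: "letter_base x \<in> verts \<Gamma>" using j joinedD by blast
  have "[x] @ (u @ [y]) @ [] \<asymp> [x] @ (y' # u') @ []"
    by (rule peq_context[OF IH]) (use x in auto)
  moreover have "[] @ [x, y'] @ u' \<asymp> [] @ [flip (arc (letter_base y) (letter_base x)) y', x'] @ u'"
    by (rule peq_context) (use letter_swap[of x y'] j peq_words[OF IH] in \<open>auto simp: x'_def y'_def\<close>)
  moreover have "flip (arc (letter_base y) (letter_base x)) y'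
      = flip (odd (length (filter (arc (letter_base y)) (map letter_base (x # u))))) y"
    by (auto simp: y'_def flip_def)
  ultimately show ?case
    by (auto simp: x'_def[symmetric] u'_def[symmetric] intro: pres_trans)
qed

text \<open>
  If \<open>xs\<close> is a product of distinct vertices of a clique, all of odd out-degree in it, then
  \<open>ys = xs\<close> and the claim is that \<open>xs\<close> is an involution. The induction needs signs that vary:
  cancelling the first letter against its partner inverts some of the remaining letters
  of \<open>xs\<close> only, namely those with an arc to it, and these are the letters whose out-degree
  changes its parity when the vertex is removed.
\<close>

lemma clique_product_trivial:
  assumes "map letter_base xs = bs" "distinct bs" "set bs \<subseteq> verts \<Gamma>"
    and "\<forall>a\<in>set bs. \<forall>b\<in>set bs. a \<noteq> b \<longrightarrow> joined a b"
    and "ys = map (\<lambda>x. flip (even (length (filter (arc (letter_base x)) bs))) x) xs"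
  shows "xs @ ys \<asymp> []"
  using assms
proof (induction bs arbitrary: xs ys)
  case Nil
  then show ?case by (auto intro: pres_refl)
next
  case (Cons a bs)
  then obtain x u where xs: "xs = x # u" and x: "letter_base x = a" and u: "map letter_base u = bs"
    by auto
  define y where "y = flip (even (length (filter (arc a) bs))) x"
  define v where "v = map (\<lambda>z. flip (even (length (filter (arc (letter_base z)) (a # bs)))) z) u"
  define u' where "u' = map (\<lambda>z. flip (arc (letter_base z) a) z) u"
  have ys: "ys = y # v"
    using Cons.prems by (simp add: y_def v_def xs x)
  have a: "a \<in> verts \<Gamma>" using Cons.prems by simp
  have base_v: "letter_base ` set v \<subseteq> set bs"
    by (auto simp: v_def u[symmetric])
  then have v: "v \<in> words" using Cons.prems by (auto simp: group_words_def)
  have base_y: "letter_base y = a" by (simp add: y_def x)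
  have "joined (letter_base z) a" if "z \<in> set u" for z
  proof -
    have "letter_base z \<in> set bs" using that u by auto
    then show ?thesis using Cons.prems(2,4) by auto
  qed
  then have move: "u @ [y] \<asymp> letter_inv x # u'"
    using move_letter_left[of u y] a by (simp add: base_y u'_def u) (simp add: y_def flip_def split: if_splits)
  \<comment> \<open>Passing \<open>u\<close>, the letter \<open>y\<close> has become the inverse of \<open>x\<close> and cancels with it.\<close>
  have "[x] @ (u @ [y]) @ v \<asymp> [x] @ (letter_inv x # u') @ v"
    by (rule peq_context[OF move]) (use a x v in auto)
  moreover have "[] @ [x, letter_inv x] @ u' @ v \<asymp> [] @ [] @ u' @ v"
    by (rule peq_context, rule pres_cancel) (use a x v peq_words[OF move] in auto)
  moreover have "u' @ v \<asymp> []"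
  proof (rule Cons.IH)
    show "map letter_base u' = bs" by (simp add: u'_def u[symmetric] comp_def)
    show "v = map (\<lambda>x. flip (even (length (filter (arc (letter_base x)) bs))) x) u'"
      by (auto simp: v_def u'_def flip_def)
  qed (use Cons.prems in auto)
  ultimately show ?case
    by (auto simp: ys xs intro: pres_trans)
qed

section \<open>Involutions and the parity of exponents\<close>

abbreviation exponents :: "'a letter list \<Rightarrow> 'a \<Rightarrow> nat" where
  "exponents w a \<equiv> count_list (map letter_base w) a"

text \<open>
  The sign that \<open>a\<close> picks up when it is moved past all letters of \<open>w\<close>.
\<close>

definition vertex_sign :: "'a \<Rightarrow> 'a letter list \<Rightarrow> int" where
  "vertex_sign a w = (-1) ^ length (filter (arc a) (map letter_base w))"

lemma vertex_sign_simps [simp]: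
  "vertex_sign a [] = 1"
  "vertex_sign a (x # w) = (if arc a (letter_base x) then - 1 else 1) * vertex_sign a w"
  by (auto simp: vertex_sign_def)

text \<open>
  The exponent sum of \<open>a\<close>, corrected by signs: \<open>a\<close> becomes a translation and its
  out-neighbours, which invert it, become reflections. Because of these signs the exponent
  sum is not additive, but the affine maps compose.
\<close>

definition line_act :: "'a \<Rightarrow> 'a letter \<Rightarrow> int \<Rightarrow> int" where
  "line_act a x n = (if letter_base x = a then n + letter_sign x
     else if arc a (letter_base x) then - n else n)"

lemma line_act_respects: "u \<asymp> v \<Longrightarrow> foldr (line_act a) u n = foldr (line_act a) v n"
proof (rule tRAAG_foldr_respects[where M = UNIV])
  fix c d s assume "arc c d"
  then show "line_act a (Gen c) (line_act a (Gen d) (line_act a (Gen c) s)) = line_act a (Gen d) s"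
    using arc_asym by (auto simp: line_act_def)
qed (auto simp: line_act_def dest: undirected_edgeD)

lemma line_act_affine:
  "\<exists>e. (\<forall>n. foldr (line_act a) w n = vertex_sign a w * n + e) \<and> odd e = odd (exponents w a)"
proof (induction w)
  case (Cons x w)
  then obtain e where e: "\<And>n. foldr (line_act a) w n = vertex_sign a w * n + e"
    "odd e = odd (exponents w a)" by blast
  have step: "foldr (line_act a) (x # w) n = line_act a x (vertex_sign a w * n + e)" for n
    by (simp add: e)
  consider "letter_base x = a" | "letter_base x \<noteq> a" "arc a (letter_base x)"
    | "letter_base x \<noteq> a" "\<not> arc a (letter_base x)" by blast
  then show ?case
  proof cases
    case 1
    then show ?thesis by (intro exI[of _ "e + letter_sign x"]) (simp only: step, simp add: e line_act_def)
  next
    case 2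
    then show ?thesis by (intro exI[of _ "- e"]) (simp only: step, simp add: e line_act_def)
  next
    case 3
    then show ?thesis by (intro exI[of _ e]) (simp only: step, simp add: e line_act_def)
  qed
qed auto

text \<open>
  For nonadjacent \<open>a\<close> and \<open>b\<close>, the maps \<open>Z \<mapsto> Z + Y\<close> and \<open>Y \<mapsto> Y + 1\<close> generate a Heisenberg
  group. Conjugation by \<open>(Y, Z) \<mapsto> (t Y, s t Z)\<close> multiplies the exponent of the first map by the
  sign \<open>s\<close> and that of the second by \<open>t\<close>, and the other vertices act in this way. No relation is imposed on \<open>a\<close> and \<open>b\<close> together, which is where
  nonadjacency is used.
\<close>

definition plane_act :: "'a \<Rightarrow> 'a \<Rightarrow> 'a letter \<Rightarrow> int \<times> int \<Rightarrow> int \<times> int" where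
  "plane_act a b x = (\<lambda>(Y, Z).
     if letter_base x = a then (Y, Z + letter_sign x * Y)
     else if letter_base x = b then (Y + letter_sign x, Z)
     else let s = (if arc a (letter_base x) then - 1 else 1);
              t = (if arc b (letter_base x) then - 1 else 1)
          in (t * Y, s * t * Z))"

lemma plane_act_respects:
  assumes "u \<asymp> v" "\<not> joined a b" "a \<noteq> b"
  shows "foldr (plane_act a b) u p = foldr (plane_act a b) v p"
  using assms(1)
proof (rule tRAAG_foldr_respects[where M = UNIV])
  fix c d s assume "arc c d"
  moreover have "\<not> arc a b" "\<not> arc b a"
    using assms arc_joined joined_sym by blast+
  ultimately show "plane_act a b (Gen c) (plane_act a b (Gen d) (plane_act a b (Gen c) s))
      = plane_act a b (Gen d) s"
    using arc_asym[of c d] assms(3) by (auto simp: plane_act_def Let_def split: prod.splits)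
next
  fix c d s assume "undirected_edge \<Gamma> c d"
  moreover have "\<not> undirected_edge \<Gamma> a b" "\<not> undirected_edge \<Gamma> b a"
    using assms undirected_edgeD joined_sym by blast+
  ultimately show "plane_act a b (Gen c) (plane_act a b (Gen d) s)
      = plane_act a b (Gen d) (plane_act a b (Gen c) s)"
    using undirected_edgeD[of c d] by (auto simp: plane_act_def Let_def algebra_simps split: prod.splits)
qed (auto simp: plane_act_def Let_def)

text \<open>
  Modulo 2 the coefficients \<open>\<beta>\<close> and \<open>k\<close> are the two abelian coordinates of the Heisenberg
  group, and the signs are invisible.
\<close>

lemma plane_act_affine:
  assumes "a \<noteq> b"
  shows "\<exists>t k \<alpha> \<beta> z. (\<forall>Y Z. foldr (plane_act a b) w (Y, Z) = (t * Y + k, \<alpha> * Z + \<beta> * Y + z))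
    \<and> odd t \<and> odd \<alpha> \<and> odd \<beta> = odd (exponents w a) \<and> odd k = odd (exponents w b)"
proof (induction w)
  case Nil
  show ?case
    by (rule exI[of _ 1], rule exI[of _ 0], rule exI[of _ 1], rule exI[of _ 0], rule exI[of _ 0]) simp
next
  case (Cons x w)
  then obtain t k \<alpha> \<beta> z where
    e: "\<And>Y Z. foldr (plane_act a b) w (Y, Z) = (t * Y + k, \<alpha> * Z + \<beta> * Y + z)"
    and o: "odd t" "odd \<alpha>" "odd \<beta> = odd (exponents w a)" "odd k = odd (exponents w b)" by blast
  have intro: ?case
    if "\<And>Y Z. plane_act a b x (t * Y + k, \<alpha> * Z + \<beta> * Y + z) = (t' * Y + k', \<alpha>' * Z + \<beta>' * Y + z')"
      "odd t'" "odd \<alpha>'" "odd \<beta>' = odd (exponents (x # w) a)" "odd k' = odd (exponents (x # w) b)"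
    for t' k' \<alpha>' \<beta>' z'
    using that by (simp only: foldr_Cons comp_apply e) blast
  consider "letter_base x = a" | "letter_base x = b" | "letter_base x \<noteq> a" "letter_base x \<noteq> b"
    by blast
  then show ?case
  proof cases
    case 1
    show ?thesis
    proof (rule intro)
      show "plane_act a b x (t * Y + k, \<alpha> * Z + \<beta> * Y + z)
          = (t * Y + k, \<alpha> * Z + (\<beta> + letter_sign x * t) * Y + (z + letter_sign x * k))" for Y Z
        by (simp add: plane_act_def 1 algebra_simps)
    qed (use 1 assms o in auto)
  next
    case 2
    show ?thesis
    proof (rule intro)
      show "plane_act a b x (t * Y + k, \<alpha> * Z + \<beta> * Y + z)
          = (t * Y + (k + letter_sign x), \<alpha> * Z + \<beta> * Y + z)" for Y Z
        using assms by (simp add: plane_act_def 2)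
    qed (use 2 assms o in auto)
  next
    case 3
    define s' t' :: int where "s' = (if arc a (letter_base x) then - 1 else 1)"
      and "t' = (if arc b (letter_base x) then - 1 else 1)"
    have odd: "odd s'" "odd t'" by (simp_all add: s'_def t'_def)
    show ?thesis
    proof (rule intro)
      show "plane_act a b x (t * Y + k, \<alpha> * Z + \<beta> * Y + z)
          = (t' * t * Y + t' * k, s' * t' * \<alpha> * Z + s' * t' * \<beta> * Y + s' * t' * z)" for Y Z
        using 3 by (simp add: plane_act_def Let_def algebra_simps flip: s'_def t'_def)
    qed (use 3 o odd in auto)
  qed
qed

lemma involution_out_neighbour:
  assumes "w @ w \<asymp> []" "odd (exponents w a)"
  shows "\<exists>b. arc a b \<and> odd (exponents w b)"
proof -
  obtain e where e: "\<And>n. foldr (line_act a) w n = vertex_sign a w * n + e" "odd e"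
    using line_act_affine[of a w] assms(2) by blast
  have "foldr (line_act a) (w @ w) 0 = 0"
    using line_act_respects[OF assms(1)] by simp
  then have "(vertex_sign a w + 1) * e = 0"
    by (simp add: e(1) algebra_simps)
  then have "vertex_sign a w = - 1"
    using e(2) by auto
  then have "odd (length (filter (arc a) (map letter_base w)))"
    unfolding vertex_sign_def by (metis one_neq_neg_one uminus_power_if power_one)
  then show ?thesis
    by (rule odd_length_filter_imp_odd_count)
qed

text \<open>
  The image of the origin under \<open>w\<^sup>2\<close> has \<open>Z\<close>-coordinate \<open>(\<alpha> + 1) z + \<beta> k\<close>, which is odd if \<open>\<alpha>\<close>, \<open>\<beta>\<close>
  and \<open>k\<close> are; so it does not vanish.
\<close>

lemma involution_joined:
  assumes "w @ w \<asymp> []" "odd (exponents w a)" "odd (exponents w b)" "a \<noteq> b"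
  shows "joined a b"
proof (rule ccontr)
  assume "\<not> joined a b"
  obtain t k \<alpha> \<beta> z where
    e: "\<And>Y Z. foldr (plane_act a b) w (Y, Z) = (t * Y + k, \<alpha> * Z + \<beta> * Y + z)"
    and o: "odd t" "odd \<alpha>" "odd \<beta>" "odd k"
    using plane_act_affine[OF assms(4), of w] assms(2,3) by blast
  have "foldr (plane_act a b) (w @ w) (0, 0) = (0, 0)"
    using plane_act_respects[OF assms(1) \<open>\<not> joined a b\<close> assms(4)] by simp
  then have "\<beta> * k = - (\<alpha> + 1) * z"
    by (simp add: e algebra_simps)
  moreover have "odd (\<beta> * k)" "even (- (\<alpha> + 1) * z)"
    using o by auto
  ultimately show False by simp
qed

section \<open>A twisted Magnus representation\<close>

text \<open>
  The effect on the monomial \<open>m\<close> of changing the sign of every variable that is inverted by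
  the generator \<open>v\<close>.
\<close>

definition twist :: "'a \<Rightarrow> 'a list \<Rightarrow> int" where
  "twist v m = (-1) ^ length (filter (\<lambda>c. arc c v) m)"

lemma twist_simps [simp]:
  "twist v [] = 1"
  "twist v (c # m) = (if arc c v then - 1 else 1) * twist v m"
  "twist v (m @ m') = twist v m * twist v m'"
  by (auto simp: twist_def power_add)

lemma twist_square [simp]: "twist v m * twist v m = 1" "twist v m * (twist v m * k) = k"
proof -
  show 1: "twist v m * twist v m = 1"
    by (simp add: twist_def flip: power_add)
  show "twist v m * (twist v m * k) = k"
    using 1 by (simp add: mult.assoc[symmetric])
qed

text \<open>
  Linear functionals on the monomials of the ring in which \<open>X\<^sub>a\<close> and \<open>X\<^sub>b\<close> commute for adjacent
  \<open>a\<close> and \<open>b\<close>, and \<open>X\<^sub>a\<^sup>2 = 0\<close>. A monomial is represented by all lists that spell it. Functionals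
  are used in place of series because they can be supported on bounded degrees, and
  because equations between monomials become conditions on functions of lists.
\<close>

definition coefficient_functions :: "('a list \<Rightarrow> int) set" where
  "coefficient_functions = {f. (\<forall>p a b q. joined a b \<longrightarrow> f (p @ [a, b] @ q) = f (p @ [b, a] @ q))
     \<and> (\<forall>p a q. f (p @ [a, a] @ q) = 0)}"

text \<open>
  The transpose of multiplication by \<open>1 \<plusminus> X\<^sub>v\<close>, followed by the sign change of variables that
  belongs to \<open>v\<close>.
\<close>

definition series_act :: "'a letter \<Rightarrow> ('a list \<Rightarrow> int) \<Rightarrow> 'a list \<Rightarrow> int" where
  "series_act x f m = twist (letter_base x) m * (f m + letter_sign x * f (m @ [letter_base x]))"

lemma coefficient_functionsI:
  assumes "\<And>p a b q. joined a b \<Longrightarrow> f (p @ [a, b] @ q) = f (p @ [b, a] @ q)"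
    and "\<And>p a q. f (p @ [a, a] @ q) = 0"
  shows "f \<in> coefficient_functions"
  using assms unfolding coefficient_functions_def by blast

lemma coefficient_functions_swap:
  "f \<in> coefficient_functions \<Longrightarrow> joined a b \<Longrightarrow> f (p @ a # b # q) = f (p @ b # a # q)"
  and coefficient_functions_repeat: "f \<in> coefficient_functions \<Longrightarrow> f (p @ a # a # q) = 0"
  by (auto simp: coefficient_functions_def)

lemma coefficient_functions_diff:
  assumes f: "f \<in> coefficient_functions" and h: "h \<in> coefficient_functions"
  shows "(\<lambda>m. f m - h m) \<in> coefficient_functions"
proof (rule coefficient_functionsI)
  show "f (p @ [a, a] @ q) - h (p @ [a, a] @ q) = 0" for p a q
    using f h by (simp add: coefficient_functions_repeat)
next
  show "f (p @ [a, b] @ q) - h (p @ [a, b] @ q) = f (p @ [b, a] @ q) - h (p @ [b, a] @ q)"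
    if "joined a b" for p a b q
    using coefficient_functions_swap[OF f that, of p] coefficient_functions_swap[OF h that, of p] by simp
qed

lemma series_act_closed:
  assumes f: "f \<in> coefficient_functions"
  shows "series_act x f \<in> coefficient_functions"
proof (rule coefficient_functionsI)
  show "series_act x f (p @ [a, a] @ q) = 0" for p a q
    using f by (simp add: series_act_def coefficient_functions_repeat)
next
  show "series_act x f (p @ [a, b] @ q) = series_act x f (p @ [b, a] @ q)" if "joined a b" for p a b q
    using coefficient_functions_swap[OF f that, of p] by (simp add: series_act_def)
qed

lemma foldr_series_act_closed:
  "f \<in> coefficient_functions \<Longrightarrow> foldr series_act w f \<in> coefficient_functions"
  by (induction w) (auto intro: series_act_closed)

text \<open>
  For an arc from \<open>a\<close> to \<open>b\<close> the sign change that comes with \<open>b\<close> replaces \<open>1 + X\<^sub>a\<close> by \<open>1 - X\<^sub>a\<close>,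
  which is its inverse because \<open>X\<^sub>a\<^sup>2 = 0\<close>; this is the relation \<open>aba = b\<close>.
\<close>

lemma series_act_respects:
  assumes "u \<asymp> v" "f \<in> coefficient_functions"
  shows "foldr series_act u f = foldr series_act v f"
  using assms(1)
proof (rule tRAAG_foldr_respects[where M = coefficient_functions])
  fix x f assume f: "f \<in> coefficient_functions"
  show "series_act x (series_act (letter_inv x) f) = f"
    using coefficient_functions_repeat[OF f, of _ _ "[]"]
    by (auto simp: series_act_def algebra_simps)
next
  fix a b f assume f: "f \<in> coefficient_functions" and ab: "undirected_edge \<Gamma> a b"
  then have "joined a b" "\<not> arc a b" "\<not> arc b a" using undirected_edgeD by auto
  then show "series_act (Gen a) (series_act (Gen b) f) = series_act (Gen b) (series_act (Gen a) f)"
    using coefficient_functions_swap[OF f, of a b _ "[]"]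
    by (auto simp: series_act_def algebra_simps)
next
  fix a b f assume f: "f \<in> coefficient_functions" and ab: "arc a b"
  then have j: "joined a b" "\<not> arc b a" using arc_joined arc_asym by auto
  \<comment> \<open>The monomial \<open>X\<^sub>a X\<^sub>b X\<^sub>a = X\<^sub>a\<^sup>2 X\<^sub>b\<close> vanishes.\<close>
  have "f (m @ [a, b, a]) = 0" for m
    using coefficient_functions_swap[OF f j(1), of m "[a]"] 
      coefficient_functions_repeat[OF f, of "m @ [b]" a "[]"] by simp
  then show "series_act (Gen a) (series_act (Gen b) (series_act (Gen a) f)) = series_act (Gen b) f"
    using coefficient_functions_swap[OF f j(1), of _ "[]"] coefficient_functions_repeat[OF f, of _ _ "[]"] j ab
    by (auto simp: series_act_def algebra_simps)
qed (use assms(2) series_act_closed in auto)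

lemma foldr_series_act_linear:
  "foldr series_act w (\<lambda>m. f m + k * h m) = (\<lambda>m. foldr series_act w f m + k * foldr series_act w h m)"
  by (induction w) (auto simp: series_act_def algebra_simps)

text \<open>
  The action lowers degrees except for the signs, so on coefficients of top degree \<open>d\<close> only
  the signs remain.
\<close>

lemma series_act_leading_term:
  assumes "\<And>m. length m > d \<Longrightarrow> f m = 0" "length m \<ge> d"
  shows "foldr series_act w f m = (\<Prod>x\<leftarrow>w. twist (letter_base x) m) * f m"
  using assms(2)
proof (induction w arbitrary: m)
  case (Cons x w)
  then have "foldr series_act w f (m @ [letter_base x]) = 0"
    using assms(1) by simp
  then show ?case using Cons by (simp add: series_act_def)
qed simp

text \<open>
  Each variable \<open>X\<^sub>c\<close> of \<open>m\<close> changes its sign once for every letter of \<open>w\<close> that inverts \<open>c\<close>, which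
  is an even number of times.
\<close>

lemma even_twist_product:
  assumes "\<And>a. even (exponents w a)"
  shows "(\<Prod>x\<leftarrow>w. twist (letter_base x) m) = 1"
proof (induction m)
  case Nil
  show ?case by (induction w) auto
next
  case (Cons c m)
  have "(\<Prod>x\<leftarrow>w. twist (letter_base x) (c # m)) = vertex_sign c w * (\<Prod>x\<leftarrow>w. twist (letter_base x) m)"
    by (induction w) (auto simp: algebra_simps)
  moreover have "vertex_sign c w = 1"
    using odd_length_filter_imp_odd_count assms unfolding vertex_sign_def by (metis neg_one_even_power)
  ultimately show ?case using Cons by simp
qed

lemma foldr_concat_replicate: "foldr act (concat (replicate n w)) s = (foldr act w ^^ n) s"
  by (induction n) auto

text \<open>
  By the two preceding lemmas \<open>w\<close> acts unipotently with respect to the degree. A unipotent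
  automorphism of a torsion-free abelian group has infinite order or is trivial: if \<open>w\<close>
  maps \<open>f\<close> to \<open>f + h\<close>, where \<open>h\<close> has smaller degree and is therefore fixed by \<open>w\<close>, then \<open>w\<^sup>n\<close> maps
  \<open>f\<close> to \<open>f + n h\<close>.
\<close>

lemma even_torsion_acts_trivially:
  assumes even: "\<And>a. even (exponents w a)"
    and torsion: "concat (replicate n w) \<asymp> []" "n > 0"
    and f: "f \<in> coefficient_functions" "\<And>m. length m \<ge> d \<Longrightarrow> f m = 0"
  shows "foldr series_act w f = f"
  using f
proof (induction d arbitrary: f)
  case 0
  then have "f = (\<lambda>_. 0)" by auto
  then show ?case by (induction w) (auto simp: series_act_def)
next
  case (Suc d)
  define h where "h = (\<lambda>m. foldr series_act w f m - f m)"
  have "foldr series_act w f \<in> coefficient_functions"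
    using Suc.prems by (intro foldr_series_act_closed)
  then have "h \<in> coefficient_functions"
    using Suc.prems(1) unfolding h_def by (rule coefficient_functions_diff)
  moreover have "h m = 0" if "length m \<ge> d" for m
    using series_act_leading_term[of d f m w] even_twist_product[OF even] Suc.prems(2) that
    by (simp add: h_def)
  ultimately have h: "foldr series_act w h = h"
    by (rule Suc.IH)
  have "foldr series_act w f = (\<lambda>m. f m + h m)"
    by (simp add: h_def)
  then have "(foldr series_act w ^^ j) f = (\<lambda>m. f m + int j * h m)" for j
    by (induction j) (auto simp: foldr_series_act_linear h algebra_simps)
  moreover have "(foldr series_act w ^^ n) f = f"
    using series_act_respects[OF torsion(1) Suc.prems(1)] by (simp add: foldr_concat_replicate)
  ultimately have "f m = f m + int n * h m" for m
    by metis
  then have "h m = 0" for m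
    using torsion(2) by simp
  then show ?case
    by (auto simp: h_def)
qed

section \<open>Faithfulness of the Magnus representation\<close>

end

text \<open>
  A syllable is a power of a generator. Since \<open>X\<^sub>a\<^sup>2 = 0\<close> in the representation, a power of a
  generator acts by a polynomial of degree 1, and the number of syllables, not the length
  of a word, is what its degree sees.
\<close>

definition syllable_word :: "('a letter \<times> nat) list \<Rightarrow> 'a letter list" where
  "syllable_word ss = concat (map (\<lambda>(x, n). replicate n x) ss)"

lemma syllable_word_simps [simp]:
  "syllable_word [] = []"
  "syllable_word ((x, n) # ss) = replicate n x @ syllable_word ss"
  "syllable_word (ss @ ss') = syllable_word ss @ syllable_word ss'"
  by (simp_all add: syllable_word_def)

abbreviation syllable_bases :: "('a letter \<times> nat) list \<Rightarrow> 'a list" where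
  "syllable_bases \<equiv> map (\<lambda>s. letter_base (fst s))"

context tRAAG_graph
begin

text \<open>
  The transpose of \<open>(1 \<plusminus> X\<^sub>v)\<^sup>n = 1 \<plusminus> n X\<^sub>v\<close>.
\<close>

lemma series_act_power:
  assumes f: "f \<in> coefficient_functions"
  shows "foldr series_act (replicate n x) f m
    = twist (letter_base x) m ^ n * (f m + int n * letter_sign x * f (m @ [letter_base x]))"
  using coefficient_functions_repeat[OF f, of _ _ "[]"]
  by (induction n arbitrary: m) (auto simp: series_act_def algebra_simps)

text \<open>
  The product of the factors \<open>1 + n X\<^sub>v\<close> over the syllables has a single term whose degree is
  the number of syllables: the product of all \<open>n X\<^sub>v\<close>. Up to a sign, \<open>k\<close> is the product of the
  exponents. The statement allows an \<open>m\<close> shorter than \<open>d - length ss\<close>, where both sides vanish,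
  because choosing the constant term of the first factor leads to this situation.
\<close>

lemma series_act_syllables:
  assumes f: "f \<in> coefficient_functions" "\<And>m. length m \<noteq> d \<Longrightarrow> f m = 0"
    and "length m + length ss \<le> d"
  shows "\<exists>k. foldr series_act (syllable_word ss) f m = k * f (m @ syllable_bases ss)
    \<and> (0 \<notin> snd ` set ss \<longrightarrow> k \<noteq> 0)"
  using assms(3)
proof (induction ss arbitrary: m)
  case Nil
  then show ?case by (intro exI[of _ 1]) simp
next
  case (Cons s ss)
  obtain x n where s: "s = (x, n)" by (cases s)
  let ?v = "letter_base x"
  let ?h = "foldr series_act (syllable_word ss) f"
  have "f (m @ syllable_bases ss) = 0"
    using Cons.prems f(2) by simp
  moreover obtain k where "?h m = k * f (m @ syllable_bases ss)"
    using Cons.IH[of m] Cons.prems by auto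
  ultimately have 0: "?h m = 0" by simp
  obtain k where k: "?h (m @ [?v]) = k * f (m @ syllable_bases (s # ss))"
    "0 \<notin> snd ` set ss \<longrightarrow> k \<noteq> 0"
    using Cons.IH[of "m @ [?v]"] Cons.prems by (auto simp: s)
  have "foldr series_act (syllable_word (s # ss)) f m
      = twist ?v m ^ n * int n * letter_sign x * ?h (m @ [?v])"
    using series_act_power[OF foldr_series_act_closed[OF f(1)]] by (simp add: s 0)
  moreover have "twist ?v m \<noteq> 0" "letter_sign x \<noteq> 0"
    by (simp_all add: twist_def letter_sign_nonzero)
  ultimately show ?case
    using k by (intro exI[of _ "twist ?v m ^ n * int n * letter_sign x * k"]) (auto simp: s)
qed

text \<open>
  Equality of the monomials spelled by two lists, before imposing \<open>X\<^sub>a\<^sup>2 = 0\<close>.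
\<close>

inductive trace_eq :: "'a list \<Rightarrow> 'a list \<Rightarrow> bool" where
  trace_refl: "trace_eq l l"
| trace_swap: "trace_eq l (p @ [a, b] @ q) \<Longrightarrow> joined a b \<Longrightarrow> trace_eq l (p @ [b, a] @ q)"

lemma trace_eq_length: "trace_eq l l' \<Longrightarrow> length l' = length l"
  by (induction rule: trace_eq.induct) auto

text \<open>
  Exchanging whole syllables changes only signs of exponents. The sign of the second
  syllable depends on the base vertices and \<open>n\<close> alone, so that all its letters are inverted
  alike.
\<close>

lemma powers_swap:
  assumes "joined (letter_base x) (letter_base y)"
  shows "\<exists>x'. letter_base x' = letter_base x \<and> replicate n x @ replicate k y \<asymp>
    replicate k (flip (arc (letter_base y) (letter_base x) \<and> odd n) y) @ replicate n x'"
  using assms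
proof (induction k arbitrary: x)
  case 0
  then show ?case using joinedD[OF 0] by (intro exI[of _ x]) (auto intro!: pres_refl simp: group_words_def)
next
  case (Suc k)
  define y' where "y' = flip (arc (letter_base y) (letter_base x) \<and> odd n) y"
  define x1 where "x1 = flip (arc (letter_base x) (letter_base y)) x"
  have v: "letter_base x \<in> verts \<Gamma>" "letter_base y \<in> verts \<Gamma>"
    using joinedD[OF Suc.prems] by auto
  have "filter (arc (letter_base y)) (replicate n (letter_base x))
      = (if arc (letter_base y) (letter_base x) then replicate n (letter_base x) else [])"
    by (induction n) auto
  then have move: "replicate n x @ [y] \<asymp> y' # replicate n x1"
    using move_letter_left[of "replicate n x" y] Suc.prems v
    by (cases "arc (letter_base y) (letter_base x)") (auto simp: y'_def x1_def)
  obtain x' where x': "letter_base x' = letter_base x1"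
    "replicate n x1 @ replicate k y \<asymp> replicate k y' @ replicate n x'"
    using Suc.IH[of x1] Suc.prems by (auto simp: x1_def y'_def)
  have "[] @ (replicate n x @ [y]) @ replicate k y \<asymp> [] @ (y' # replicate n x1) @ replicate k y"
    by (rule peq_context[OF move]) (use v in \<open>auto simp: group_words_def\<close>)
  moreover have "[y'] @ (replicate n x1 @ replicate k y) @ [] \<asymp> [y'] @ (replicate k y' @ replicate n x') @ []"
    by (rule peq_context[OF x'(2)]) (use v in \<open>auto simp: y'_def\<close>)
  ultimately have "replicate n x @ replicate (Suc k) y \<asymp> replicate (Suc k) y' @ replicate n x'"
    by (auto intro: pres_trans)
  then show ?case using x'(1) by (auto simp: y'_def x1_def)
qed

lemma powers_merge:
  assumes "letter_base x = letter_base y" "replicate n x @ replicate k y \<in> words"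
  shows "\<exists>z j. letter_base z = letter_base x \<and> replicate n x @ replicate k y \<asymp> replicate j z"
proof (cases "y = x")
  case True
  then show ?thesis using assms
    by (intro exI[of _ x] exI[of _ "n + k"]) (auto simp: replicate_add intro!: pres_refl)
next
  case False
  then have y: "y = letter_inv x" using letter_eqI[OF assms(1)] by auto
  show ?thesis using assms(2)
  proof (induction n arbitrary: k)
    case 0
    then show ?case using y by (intro exI[of _ y] exI[of _ k]) (auto intro!: pres_refl)
  next
    case (Suc n)
    show ?case
    proof (cases k)
      case 0
      then show ?thesis using Suc.prems by (intro exI[of _ x] exI[of _ "Suc n"]) (auto intro!: pres_refl)
    next
      case (Suc k')
      have w: "letter_base x \<in> verts \<Gamma>" "replicate n x \<in> words" "replicate k' y \<in> words"
        using Suc.prems Suc by auto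
      obtain z j where z: "letter_base z = letter_base x" "replicate n x @ replicate k' y \<asymp> replicate j z"
        using Suc.IH[of k'] w by auto
      have "replicate n x @ [x, letter_inv x] @ replicate k' y \<asymp> replicate n x @ [] @ replicate k' y"
        by (rule peq_context, rule pres_cancel) (use w in auto)
      moreover have "replicate n x @ [x, letter_inv x] @ replicate k' y = replicate (Suc n) x @ replicate k y"
        using Suc y by (simp add: replicate_app_Cons_same)
      ultimately show ?thesis using z by (auto intro: pres_trans)
    qed
  qed
qed

text \<open>
  Owing to this, equal neighbours in any list that spells the monomial of \<open>ss\<close>, not only in
  \<open>syllable_bases ss\<close> itself, show that \<open>ss\<close> can be shortened.
\<close>

lemma trace_eq_syllables:
  assumes "trace_eq (syllable_bases ss) l" "syllable_word ss \<in> words"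
  shows "\<exists>ss'. syllable_bases ss' = l \<and> syllable_word ss \<asymp> syllable_word ss'"
  using assms
proof (induction "syllable_bases ss" l rule: trace_eq.induct)
  case trace_refl
  then show ?case by (auto intro: pres_refl)
next
  case (trace_swap p a b q)
  then obtain ss' where ss': "syllable_bases ss' = p @ [a, b] @ q" "syllable_word ss \<asymp> syllable_word ss'"
    by auto
  then obtain P x n y k Q where dec: "ss' = P @ [(x, n), (y, k)] @ Q" "syllable_bases P = p"
    "letter_base x = a" "letter_base y = b" "syllable_bases Q = q"
    by (auto simp: map_eq_append_conv map_eq_Cons_conv)
  obtain x' where x': "letter_base x' = a"
    "replicate n x @ replicate k y \<asymp> replicate k (flip (arc b a \<and> odd n) y) @ replicate n x'"
    using powers_swap[of x y n k] trace_swap.hyps dec by auto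
  have "syllable_word P @ (replicate n x @ replicate k y) @ syllable_word Q
    \<asymp> syllable_word P @ (replicate k (flip (arc b a \<and> odd n) y) @ replicate n x') @ syllable_word Q"
    by (rule peq_context[OF x'(2)]) (use peq_words(2)[OF ss'(2)] dec in auto)
  then have "syllable_word ss \<asymp> syllable_word (P @ [(flip (arc b a \<and> odd n) y, k), (x', n)] @ Q)"
    using ss'(2) dec by (auto intro: pres_trans)
  then show ?case
    by (intro exI[of _ "P @ [(flip (arc b a \<and> odd n) y, k), (x', n)] @ Q"]) (use dec x' in auto)
qed

text \<open>
  Faithfulness, applied to a word that acts trivially. Write \<open>w\<close> with as few syllables as
  possible. Then no rearrangement of their base vertices has two equal neighbours, as the
  two syllables could be merged. So the monomial spelled by the base vertices is nonzero,
  and the functional \<open>f\<close> that picks its coefficient is a legitimate one. Acting by \<open>w\<close> on \<open>f\<close> and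
  taking the value at the empty list gives the coefficient of this monomial in the series
  of \<open>w\<close>, which is not zero; but \<open>w\<close> acts trivially, so the monomial is \<open>1\<close> and \<open>w\<close> has no
  syllables.
\<close>

lemma even_torsion_trivial:
  assumes w: "w \<in> words" "\<And>a. even (exponents w a)"
    and torsion: "concat (replicate n w) \<asymp> []" "n > 0"
  shows "w \<asymp> []"
proof -
  have "syllable_word (map (\<lambda>x. (x, 1)) w) = w"
    by (induction w) auto
  then have "\<exists>ss. w \<asymp> syllable_word ss"
    using w by (metis pres_refl)
  then obtain ss where ss: "w \<asymp> syllable_word ss"
    and min: "\<And>ss'. w \<asymp> syllable_word ss' \<Longrightarrow> length ss \<le> length ss'"
    using ex_has_least_nat[of "\<lambda>ss. w \<asymp> syllable_word ss" _ length] by blast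
  let ?l = "syllable_bases ss"
  have nonzero: "0 \<notin> snd ` set ss"
  proof
    assume "0 \<in> snd ` set ss"
    then obtain x where "(x, 0) \<in> set ss" by force
    then obtain P Q where "ss = P @ (x, 0) # Q" by (auto simp: in_set_conv_decomp)
    then show False using min[of "P @ Q"] ss by simp
  qed
  have no_repeat: "\<not> trace_eq ?l (p @ [a, a] @ q)" for p a q
  proof
    assume "trace_eq ?l (p @ [a, a] @ q)"
    then obtain ss' where ss': "syllable_bases ss' = p @ [a, a] @ q" "syllable_word ss \<asymp> syllable_word ss'"
      using trace_eq_syllables peq_words(2)[OF ss] by blast
    then obtain P x n y k Q where dec: "ss' = P @ [(x, n), (y, k)] @ Q" "letter_base x = letter_base y"
      by (auto simp: map_eq_append_conv map_eq_Cons_conv)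
    then obtain z j where z: "replicate n x @ replicate k y \<asymp> replicate j z"
      using powers_merge[of x y n k] peq_words(2)[OF ss'(2)] by auto
    have "syllable_word P @ (replicate n x @ replicate k y) @ syllable_word Q
      \<asymp> syllable_word P @ replicate j z @ syllable_word Q"
      by (rule peq_context[OF z]) (use peq_words(2)[OF ss'(2)] dec in auto)
    then have "w \<asymp> syllable_word (P @ [(z, j)] @ Q)"
      using ss ss'(2) dec by (auto intro: pres_trans)
    moreover have "length ss' = length ss"
      using min[of ss'] ss ss' by (metis length_map trace_eq_length \<open>trace_eq ?l _\<close>)
    ultimately show False using min dec by fastforce
  qed
  define f :: "'a list \<Rightarrow> int" where "f = (\<lambda>m. if trace_eq ?l m then 1 else 0)"
  have "trace_eq ?l (p @ [a, b] @ q) = trace_eq ?l (p @ [b, a] @ q)" if "joined a b" for p a b q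
    using that joined_sym trace_swap by blast
  then have f: "f \<in> coefficient_functions"
    using no_repeat by (auto simp: coefficient_functions_def f_def)
  have supp: "length m \<noteq> length ss \<Longrightarrow> f m = 0" for m
    using trace_eq_length by (auto simp: f_def)
  obtain k where "foldr series_act (syllable_word ss) f [] = k * f ?l" "k \<noteq> 0"
    using series_act_syllables[OF f supp, of "length ss" "[]" ss] nonzero by auto
  moreover have "f ?l = 1"
    by (simp add: f_def trace_refl)
  moreover have "foldr series_act (syllable_word ss) f = f"
    using even_torsion_acts_trivially[OF w(2) torsion f, of "Suc (length ss)"] supp
      series_act_respects[OF ss f] by simp
  ultimately have "f [] \<noteq> 0" by simp
  then have "ss = []" using supp[of "[]"] by auto
  then show ?thesis using ss by simp
qed

section \<open>Sinkless cliques, torsion and cycles\<close>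

text \<open>
  This replaces the closed cycle: it is what the parities of an involution deliver, it does
  not refer to an order of the vertices, and a set of this kind with the fewest vertices
  has the exact out-degrees that make the product of its vertices an involution.
\<close>

definition sinkless_clique :: "'a set \<Rightarrow> bool" where
  "sinkless_clique T \<longleftrightarrow> T \<noteq> {} \<and> clique \<Gamma> T \<and> (\<forall>a\<in>T. \<exists>b\<in>T. arc a b)"

lemma sinkless_clique_finite: "sinkless_clique T \<Longrightarrow> finite T"
  using mixed by (auto simp: sinkless_clique_def clique_def is_mixed_graph_def intro: finite_subset)

lemma torsion_imp_sinkless_clique:
  assumes w: "w \<in> words" "\<not> w \<asymp> []" and torsion: "concat (replicate n w) \<asymp> []" "n > 0"
  shows "sinkless_clique {a. odd (exponents w a)}"
proof -
  have "concat (replicate n (w @ w)) = concat (replicate n w) @ concat (replicate n w)"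
  proof -
    have "concat (replicate n (w @ w)) = concat (replicate (n + n) w)"
      by (induction n) auto
    then show ?thesis by (simp add: replicate_add)
  qed
  then have "concat (replicate n (w @ w)) \<asymp> []"
    using pres_append[OF torsion(1) torsion(1)] by simp
  then have square: "w @ w \<asymp> []"
    using even_torsion_trivial[of "w @ w"] w torsion(2) by simp
  then have "concat (replicate 2 w) \<asymp> []"
    by (simp add: numeral_2_eq_2)
  then have "\<exists>a. odd (exponents w a)"
    using even_torsion_trivial[of w 2] w by auto
  moreover have "a \<in> verts \<Gamma>" if "odd (exponents w a)" for a
  proof -
    have "a \<in> set (map letter_base w)"
      using that by (metis count_list_0_iff even_zero)
    then show ?thesis using w(1) by (auto simp: group_words_def)
  qed
  ultimately show ?thesis
    using involution_out_neighbour[OF square] involution_joined[OF square]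
    unfolding sinkless_clique_def clique_def by blast
qed

text \<open>
  If \<open>f\<close> chooses an out-neighbour in \<open>T\<close> for each vertex, the image of \<open>f\<close> is again a sinkless
  clique, so by minimality \<open>f\<close> permutes \<open>T\<close>. Two different choices at a single vertex cannot
  both give a permutation.
\<close>

lemma minimal_sinkless_clique_unique_out_neighbour:
  assumes T: "sinkless_clique T" and min: "\<And>T'. sinkless_clique T' \<Longrightarrow> card T \<le> card T'"
    and a: "a \<in> T" "b \<in> T" "c \<in> T" "arc a b" "arc a c"
  shows "b = c"
proof (rule ccontr)
  assume "b \<noteq> c"
  have surj: "f ` T = T" if f: "\<And>x. x \<in> T \<Longrightarrow> f x \<in> T \<and> arc x (f x)" for f
  proof -
    have "f ` T \<subseteq> T" using f by auto
    moreover have "sinkless_clique (f ` T)"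
      using T f \<open>f ` T \<subseteq> T\<close> unfolding sinkless_clique_def clique_def by blast
    ultimately show ?thesis
      using min sinkless_clique_finite[OF T] by (intro card_seteq) auto
  qed
  obtain g where g: "\<And>x. x \<in> T \<Longrightarrow> g x \<in> T \<and> arc x (g x)"
    using T unfolding sinkless_clique_def by metis
  let ?f = "g(a := b)" and ?f' = "g(a := c)"
  have "?f ` T = T" "?f' ` T = T"
    by (rule surj; use g a in auto)+
  then have "inj_on ?f T"
    using sinkless_clique_finite[OF T] by (intro eq_card_imp_inj_on) auto
  from \<open>?f' ` T = T\<close> obtain d where "d \<in> T" "?f' d = b" using a by (metis imageE)
  then have "d \<noteq> a" "?f d = ?f a" using \<open>b \<noteq> c\<close> by (auto split: if_splits)
  then show False using inj_onD[OF \<open>inj_on ?f T\<close>, of d a] \<open>d \<in> T\<close> a(1) by blast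
qed

lemma sinkless_clique_imp_involution:
  assumes "sinkless_clique T0"
  shows "\<exists>w\<in>words. \<not> w \<asymp> [] \<and> w @ w \<asymp> []"
proof -
  obtain T where T: "sinkless_clique T" and min: "\<And>T'. sinkless_clique T' \<Longrightarrow> card T \<le> card T'"
    using ex_has_least_nat[of sinkless_clique T0 card] assms by blast
  obtain bs where bs: "set bs = T" "distinct bs"
    using finite_distinct_list[OF sinkless_clique_finite[OF T]] by blast
  let ?w = "map Gen bs"
  have base: "map letter_base ?w = bs" by (simp add: comp_def)
  have "length (filter (arc a) bs) = 1" if a: "a \<in> T" for a
  proof -
    obtain b where b: "b \<in> T" "arc a b" using T a by (auto simp: sinkless_clique_def)
    then have "{x. arc a x} \<inter> set bs = {b}"
      using minimal_sinkless_clique_unique_out_neighbour[OF T min a] bs by auto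
    then show ?thesis using distinct_length_filter[OF bs(2), of "arc a"] by simp
  qed
  then have "?w @ ?w \<asymp> []"
    using T bs by (intro clique_product_trivial[OF base])
      (auto simp: sinkless_clique_def clique_def)
  moreover have "?w \<in> words"
    using T bs by (auto simp: sinkless_clique_def clique_def group_words_def)
  moreover have "\<not> ?w \<asymp> []"
  proof
    assume 1: "?w \<asymp> []"
    obtain a where "a \<in> T" using T by (auto simp: sinkless_clique_def)
    moreover have "count_list bs a = 1" if "distinct bs" "a \<in> set bs" for bs :: "'a list"
      using that by (induction bs) (auto simp: count_notin)
    ultimately have "odd (exponents ?w a)"
      unfolding base using bs by simp
    then obtain e where "foldr (line_act a) ?w 0 = e" "odd e"
      using line_act_affine[of a ?w] by auto
    then show False using line_act_respects[OF 1, of a 0] by simp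
  qed
  ultimately show ?thesis by blast
qed

lemma closed_cycle_imp_sinkless_clique:
  assumes "clique \<Gamma> C" "forms_closed_cycle \<Gamma> C"
  shows "sinkless_clique C"
proof -
  obtain as where as: "set as = C" "length as \<ge> 3"
    "\<And>i. i < length as \<Longrightarrow> arc (as ! i) (as ! (Suc i mod length as))"
    using assms(2) by (auto simp: forms_closed_cycle_def)
  have "\<exists>b\<in>C. arc a b" if "a \<in> C" for a
  proof -
    have "a \<in> set as" using that by (simp only: as(1))
    then obtain i where i: "i < length as" "as ! i = a"
      by (auto simp only: in_set_conv_nth)
    from i(1) have "0 < length as" by (rule order.strict_trans1[rotated]) (rule le0)
    then have "Suc i mod length as < length as" by (rule mod_less_divisor)
    then have "as ! (Suc i mod length as) \<in> C" using nth_mem by (simp only: as(1)[symmetric])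
    moreover have "arc a (as ! (Suc i mod length as))" using as(3)[OF i(1)] by (simp only: i(2))
    ultimately show ?thesis by (rule bexI[rotated])
  qed
  moreover have "C \<noteq> {}" using as(1,2) by fastforce
  ultimately show ?thesis using assms(1) by (simp add: sinkless_clique_def)
qed

text \<open>
  The orbit of a vertex under a choice of out-neighbours is finite, so it contains a
  periodic vertex \<open>b\<close>; its orbit, of least period \<open>p\<close>, is the cycle. Periods 1 and 2 would
  require a loop or an edge with two directions.
\<close>

lemma sinkless_clique_imp_closed_cycle:
  assumes T: "sinkless_clique T"
  shows "\<exists>C. clique \<Gamma> C \<and> forms_closed_cycle \<Gamma> C"
proof -
  obtain f where f: "\<And>x. x \<in> T \<Longrightarrow> f x \<in> T \<and> arc x (f x)"
    using T unfolding sinkless_clique_def by metis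
  obtain a where a: "a \<in> T" using T by (auto simp: sinkless_clique_def)
  have in_T: "(f ^^ i) x \<in> T" if "x \<in> T" for i x
    using that f by (induction i) auto
  have "\<not> inj (\<lambda>i. (f ^^ i) a)"
  proof
    assume "inj (\<lambda>i. (f ^^ i) a)"
    moreover have "finite (range (\<lambda>i. (f ^^ i) a))"
      using sinkless_clique_finite[OF T] in_T[OF a] by (auto intro: finite_subset)
    ultimately show False using finite_imageD by blast
  qed
  then obtain i j where ij: "i < j" "(f ^^ i) a = (f ^^ j) a"
    unfolding inj_def by (metis linorder_neqE_nat)
  define b where "b = (f ^^ i) a"
  have b: "b \<in> T" using in_T[OF a] by (simp add: b_def)
  have "(f ^^ (j - i)) b = b"
  proof -
    have "(f ^^ (j - i)) b = (f ^^ (j - i + i)) a"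
      by (simp only: b_def funpow_add comp_apply)
    then show ?thesis using ij by (simp add: b_def)
  qed
  then have ex: "\<exists>p. p > 0 \<and> (f ^^ p) b = b" using ij(1) by (metis zero_less_diff)
  define p where "p = (LEAST p. p > 0 \<and> (f ^^ p) b = b)"
  have p: "p > 0" "(f ^^ p) b = b"
    using LeastI_ex[OF ex] by (simp_all add: p_def)
  have least: "p \<le> q" if "q > 0" "(f ^^ q) b = b" for q
    unfolding p_def by (rule Least_le) (use that in simp)
  have neq: "(f ^^ k) b \<noteq> (f ^^ l) b" if "k < l" "l < p" for k l
  proof
    assume eq: "(f ^^ k) b = (f ^^ l) b"
    have "(f ^^ (p - l + k)) b = (f ^^ (p - l)) ((f ^^ l) b)"
      by (simp add: funpow_add eq)
    also have "\<dots> = (f ^^ (p - l + l)) b"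
      by (simp only: funpow_add comp_apply)
    finally have "(f ^^ (p - l + k)) b = b" using that p by simp
    then show False using least[of "p - l + k"] that by simp
  qed
  let ?as = "map (\<lambda>i. (f ^^ i) b) [0..<p]"
  have "distinct ?as"
    using neq by (auto simp: distinct_map inj_on_def) (metis linorder_neqE_nat)
  moreover have cycle: "arc (?as ! i) (?as ! (Suc i mod length ?as))" if "i < length ?as" for i
  proof -
    have "(f ^^ (Suc i mod p)) b = f ((f ^^ i) b)"
      using that p by (cases "Suc i = p") auto
    then show ?thesis using that f[OF in_T[OF b, of i]] p by simp
  qed
  moreover have "length ?as \<ge> 3"
  proof (rule ccontr)
    assume "\<not> length ?as \<ge> 3"
    then consider "p = 1" | "p = 2" using p by force
    then show False
    proof cases
      case 1
      then show False using f[OF b] p by simp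
    next
      case 2
      then have "f (f b) = b" using p by (simp add: numeral_2_eq_2)
      then show False using f[OF b] f[of "f b"] arc_asym by metis
    qed
  qed
  ultimately have "forms_closed_cycle \<Gamma> (set ?as)"
    unfolding forms_closed_cycle_def by blast
  moreover have "set ?as \<subseteq> T" using in_T[OF b] by auto
  then have "clique \<Gamma> (set ?as)"
    using T unfolding sinkless_clique_def clique_def by blast
  ultimately show ?thesis by blast
qed

lemma word_class_pow:
  assumes "w \<in> words"
  shows "word_class w [^]\<^bsub>tRAAG \<Gamma>\<^esub> (n::nat) = word_class (concat (replicate n w))"
proof (induction n)
  case 0
  then show ?case by (simp add: nat_pow_def word_class_simps)
next
  case (Suc n)
  have "concat (replicate n w) \<in> words" using assms by (induction n) auto
  moreover have "concat (replicate n w) @ w = w @ concat (replicate n w)" by (induction n) auto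
  ultimately show ?case
    using Suc assms by (simp add: nat_pow_def word_class_simps)
qed

lemma has_torsion_iff_words:
  "has_torsion (tRAAG \<Gamma>) \<longleftrightarrow>
    (\<exists>w\<in>words. \<not> w \<asymp> [] \<and> (\<exists>n>0. concat (replicate n w) \<asymp> []))"
proof -
  have "concat (replicate n w) \<in> words" if "w \<in> words" for w n
    using that by (induction n) auto
  then show ?thesis
    unfolding has_torsion_def word_class_simps(1,2) bex_simps
    by (intro bex_cong refl) (simp add: word_class_pow word_class_simps(4))
qed

end

theorem theorem5p16:
  fixes \<Gamma> :: "'a mixed_graph"
  assumes "is_mixed_graph \<Gamma>"
  shows "has_torsion (tRAAG \<Gamma>) \<longleftrightarrow> (\<exists>C. clique \<Gamma> C \<and> forms_closed_cycle \<Gamma> C)"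
proof -
  interpret tRAAG_graph \<Gamma> by unfold_locales (rule assms)
  show ?thesis
  proof
    assume "has_torsion (tRAAG \<Gamma>)"
    then show "\<exists>C. clique \<Gamma> C \<and> forms_closed_cycle \<Gamma> C"
      using has_torsion_iff_words torsion_imp_sinkless_clique sinkless_clique_imp_closed_cycle by blast
  next
    assume "\<exists>C. clique \<Gamma> C \<and> forms_closed_cycle \<Gamma> C"
    then obtain w where "w \<in> group_words (verts \<Gamma>)" "\<not> pres_eq (verts \<Gamma>) (tRAAG_relations \<Gamma>) w []"
      "pres_eq (verts \<Gamma>) (tRAAG_relations \<Gamma>) (w @ w) []"
      using closed_cycle_imp_sinkless_clique sinkless_clique_imp_involution by blast
    then show "has_torsion (tRAAG \<Gamma>)"
      unfolding has_torsion_iff_words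
      by (intro bexI[of _ w] conjI exI[of _ "2::nat"]) (simp_all add: numeral_2_eq_2)
  qed
qed

end
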